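(* Let $A$, $u_k$, $J_k$, $\widehat P_k$, $E_k$ be as in the context. There is a positive number $\delta$ such that if $\|e_k\|<\delta$ then $$\|\widehat P_k\|\le\frac{2}{\lambda_2-\lambda_1}\big(1+\|E_k\|\big),$$ where $\|\widehat P_k\|=\sup_{w\perp u_k,\,w\ne0}\dfrac{w^\top\widehat P_kw}{w^\top w}$.
   Context: $A\in\mathbb{R}^{n\times n}$ is symmetric positive definite (SPD) with eigenvalues $\lambda_1<\lambda_2<\dots<\lambda_n$ and corresponding unit eigenvectors $v_1,\dots,v_n$. Norms of vectors are Euclidean. Newton iteration for the smallest eigenpair: $u_0$ is a unit vector; for $k\ge 0$, $\theta_k=u_k^\top A u_k$, $r_k=Au_k-\theta_k u_k$ (residual vector), $e_k=u_k-v_1$, and $$J_k=(I-u_ku_k^\top)(A-\theta_k I)(I-u_ku_k^\top).$$ The vector $s_k\ne0$ is the solution, orthogonal to $u_k$, of $J_k s_k=-r_k$, and $u_{k+1}=(u_k+s_k)/\|u_k+s_k\|$. Preconditioners: $\widehat P_0=(LL^\top)^{-1}$ with $L$ a nonsingular lower triangular (incomplete Cholesky) factor, and $$\widehat P_{k+1}=-\frac{s_ks_k^\top}{s_k^\top r_k}+\Big(I-\frac{s_kr_k^\top}{s_k^\top r_k}\Big)\widehat P_k\Big(I-\frac{r_ks_k^\top}{s_k^\top r_k}\Big).$$ The matrices $\widehat P_k$ are taken to be SPD (which holds for iterates close enough to $v_1$). For $u_k$ sufficiently close to $v_1$, $J_k$ is positive semidefinite (positive definite on $u_k^\perp$), $J_k^{1/2}$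 denotes its positive semidefinite square root, and $$E_k=I-J_k^{1/2}\widehat P_kJ_k^{1/2},\qquad \|E_k\|=\sup\{|z^\top E_kz|: z\perp u_k,\ \|z\|=1\}$$ (norms are understood for the restriction to the subspace orthogonal to $u_k$). The number $\delta$ does not depend on $k$. *)

theory Defs
  imports "HOL-Analysis.Analysis"
begin

definition spd :: "real^'n^'n \<Rightarrow> bool" where
  "spd M \<longleftrightarrow> transpose M = M \<and> (\<forall>x. x \<noteq> 0 \<longrightarrow> x \<bullet> (M *v x) > 0)"

definition psd :: "real^'n^'n \<Rightarrow> bool" where
  "psd M \<longleftrightarrow> transpose M = M \<and> (\<forall>x. x \<bullet> (M *v x) \<ge> 0)"

text \<open>Meaningful only if \<open>M\<close> is positive semidefinite, in which case the root exists and is unique.\<close>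
definition psd_sqrt :: "real^'n^'n \<Rightarrow> real^'n^'n" where
  "psd_sqrt M = (THE S. psd S \<and> S ** S = M)"

definition outer :: "real^'n \<Rightarrow> real^'n \<Rightarrow> real^'n^'n" where
  "outer x y = (\<chi> i j. x $ i * y $ j)"

definition lower_triangular :: "real^('n::{finite,linorder})^('n::{finite,linorder}) \<Rightarrow> bool" where
  "lower_triangular L \<longleftrightarrow> (\<forall>i j. i < j \<longrightarrow> L $ i $ j = 0)"

text \<open>As \<open>CARD('n)\<close> distinct eigenvalues are listed, these are all the eigenvalues of \<open>A\<close>.\<close>
definition ordered_eigenpairs :: "real^'n^'n \<Rightarrow> (nat \<Rightarrow> real) \<Rightarrow> (nat \<Rightarrow> real^'n) \<Rightarrow> bool" where
  "ordered_eigenpairs A lam v \<longleftrightarrow>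
     strict_mono_on {1..CARD('n)} lam \<and>
     (\<forall>i\<in>{1..CARD('n)}. A *v v i = lam i *\<^sub>R v i \<and> norm (v i) = 1)"

definition rayleigh :: "real^'n^'n \<Rightarrow> real^'n \<Rightarrow> real" where
  "rayleigh A u = u \<bullet> (A *v u)"

definition residual :: "real^'n^'n \<Rightarrow> real^'n \<Rightarrow> real^'n" where
  "residual A u = A *v u - rayleigh A u *\<^sub>R u"

definition newton_J :: "real^'n^'n \<Rightarrow> real^'n \<Rightarrow> real^'n^'n" where
  "newton_J A u = (mat 1 - outer u u) ** (A - rayleigh A u *\<^sub>R mat 1) ** (mat 1 - outer u u)"

definition newton_iteration :: "real^'n^'n \<Rightarrow> (nat \<Rightarrow> real^'n) \<Rightarrow> (nat \<Rightarrow> real^'n) \<Rightarrow> bool" where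
  "newton_iteration A u s \<longleftrightarrow>
     norm (u 0) = 1 \<and>
     (\<forall>k. s k \<noteq> 0 \<and> s k \<bullet> u k = 0 \<and> newton_J A (u k) *v s k = - residual A (u k) \<and>
          u (Suc k) = (1 / norm (u k + s k)) *\<^sub>R (u k + s k))"

definition precond_update :: "real^'n \<Rightarrow> real^'n \<Rightarrow> real^'n^'n \<Rightarrow> real^'n^'n" where
  "precond_update s r P =
     - ((1 / (s \<bullet> r)) *\<^sub>R outer s s)
     + (mat 1 - (1 / (s \<bullet> r)) *\<^sub>R outer s r) ** P ** (mat 1 - (1 / (s \<bullet> r)) *\<^sub>R outer r s)"

definition precond_sequence ::
  "real^('n::{finite,linorder})^('n::{finite,linorder}) \<Rightarrow> (nat \<Rightarrow> real^('n::{finite,linorder})) \<Rightarrow>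
   (nat \<Rightarrow> real^('n::{finite,linorder})) \<Rightarrow>
   real^('n::{finite,linorder})^('n::{finite,linorder}) \<Rightarrow>
   (nat \<Rightarrow> real^('n::{finite,linorder})^('n::{finite,linorder})) \<Rightarrow> bool" where
  "precond_sequence A u s L P \<longleftrightarrow>
     lower_triangular L \<and> invertible L \<and>
     P 0 = matrix_inv (L ** transpose L) \<and>
     (\<forall>k. P (Suc k) = precond_update (s k) (residual A (u k)) (P k)) \<and>
     (\<forall>k. spd (P k))"

definition precond_error :: "real^'n^'n \<Rightarrow> real^'n \<Rightarrow> real^'n^'n \<Rightarrow> real^'n^'n" where
  "precond_error A u P = mat 1 - psd_sqrt (newton_J A u) ** P ** psd_sqrt (newton_J A u)"

definition error_norm :: "real^'n \<Rightarrow> real^'n^'n \<Rightarrow> real" where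
  "error_norm u E = (SUP z\<in>{z. z \<bullet> u = 0 \<and> norm z = 1}. \<bar>z \<bullet> (E *v z)\<bar>)"

definition precond_norm :: "real^'n \<Rightarrow> real^'n^'n \<Rightarrow> real" where
  "precond_norm u P = (SUP w\<in>{w. w \<bullet> u = 0 \<and> w \<noteq> 0}. (w \<bullet> (P *v w)) / (w \<bullet> w))"

end

theory Submission
  imports Defs
begin

text \<open>
  For a unit vector \<open>u\<close> near \<open>v\<^sub>1\<close>, expanding in eigenvectors shows that \<open>J\<close> is bounded below by
  \<open>(\<lambda>\<^sub>2 - \<lambda>\<^sub>1) / 2\<close> on the orthogonal complement of \<open>u\<close>. Hence \<open>S = J\<^sup>1\<^sup>/\<^sup>2\<close> maps that complement
  bijectively onto itself. Writing \<open>w = S z\<close>, one gets \<open>w\<^sup>T P w = z\<^sup>T (I - E) z \<le> (1 + \<parallel>E\<parallel>) \<parallel>z\<parallel>\<^sup>2\<close>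
  and \<open>\<parallel>w\<parallel>\<^sup>2 = z\<^sup>T J z \<ge> (\<lambda>\<^sub>2 - \<lambda>\<^sub>1) / 2 \<parallel>z\<parallel>\<^sup>2\<close>.
\<close>

section \<open>Spectral theorem for self-adjoint maps and symmetric matrices\<close>

text \<open>First-order condition at a minimum: for small \<open>t\<close> the linear term dominates
  and takes both signs unless its coefficient vanishes.\<close>

lemma quadratic_nonneg_imp_linear_coeff_zero:
  fixes b g :: real
  assumes "\<And>t. 0 \<le> 2 * t * b + t\<^sup>2 * g"
  shows "b = 0"
proof (rule ccontr)
  assume b: "b \<noteq> 0"
  \<comment> \<open>At \<open>t = - b / h\<close> the form equals
    \<open>b\<^sup>2 / h\<^sup>2\<close> times \<open>g - 2 * h\<close>, and the second factor is
    negative because \<open>h\<close> exceeds both 0 and \<open>g\<close>.\<close>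
  define h where "h = \<bar>g\<bar> + 1"
  have h: "h > 0" "g < h" by (auto simp: h_def)
  have "0 \<le> 2 * (- b / h) * b + (- b / h)\<^sup>2 * g" by (rule assms)
  also have "\<dots> = (b\<^sup>2 / h\<^sup>2) * (g - 2 * h)"
    using h by (simp add: field_simps power2_eq_square)
  also have "\<dots> < 0"
    using b h by (intro mult_pos_neg) auto
  finally show False by simp
qed

text \<open>Variational argument: a maximiser of \<open>x \<bullet> f x\<close> on the unit sphere
  of \<open>V\<close> is an eigenvector. Working inside an invariant subspace lets an orthonormal
  set of eigenvectors be extended later.\<close>

lemma self_adjoint_eigenvector_in_subspace:
  fixes f :: "'a::euclidean_space \<Rightarrow> 'a"
  assumes f: "linear f" and sa: "\<And>x y. x \<bullet> f y = f x \<bullet> y"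
    and V: "subspace V" "\<And>x. x \<in> V \<Longrightarrow> f x \<in> V" and ne: "\<exists>x\<in>V. x \<noteq> 0"
  obtains x c where "x \<in> V" "norm x = 1" "f x = c *\<^sub>R x"
proof -
  let ?K = "sphere 0 1 \<inter> V"
  have "compact ?K"
    using closed_subspace[OF V(1)] by (intro compact_Int_closed) auto
  moreover have "?K \<noteq> {}"
  proof -
    obtain x where x: "x \<in> V" "x \<noteq> 0" using ne by auto
    then have "(1 / norm x) *\<^sub>R x \<in> ?K" using V(1) by (auto simp: subspace_scale)
    then show ?thesis by blast
  qed
  moreover have "continuous_on ?K (\<lambda>x. x \<bullet> f x)"
    using f by (intro continuous_on_inner continuous_on_id linear_continuous_on)
      (simp add: linear_conv_bounded_linear)
  ultimately obtain x where x: "x \<in> ?K" and max: "\<And>y. y \<in> ?K \<Longrightarrow> y \<bullet> f y \<le> x \<bullet> f x"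
    using continuous_attains_sup[of ?K "\<lambda>x. x \<bullet> f x"] by blast
  define c where "c = x \<bullet> f x"
  have xx: "x \<bullet> x = 1" and xV: "x \<in> V" using x by (auto simp: norm_eq_1)
  have bound: "y \<bullet> f y \<le> c * (y \<bullet> y)" if "y \<in> V" for y
  proof (cases "y = 0")
    case True
    then show ?thesis by simp
  next
    case False
    have "(1 / norm y) *\<^sub>R y \<in> ?K" using that V(1) False by (auto simp: subspace_scale)
    from max[OF this] have "(y \<bullet> f y) / (norm y)\<^sup>2 \<le> c"
      by (simp add: linear_cmul[OF f] c_def power2_eq_square)
    then show ?thesis using False by (simp add: field_simps power2_norm_eq_inner)
  qed
  \<comment> \<open>By \<open>bound\<close>, the form
    \<open>c * (z \<bullet> z) - z \<bullet> f z\<close> is nonnegative on \<open>V\<close>, and it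
    vanishes at \<open>x\<close>. Its derivative at \<open>x\<close> in direction \<open>y\<close>
    is \<open>2 * (y \<bullet> y)\<close>, which must therefore be zero.\<close>
  define y where "y = c *\<^sub>R x - f x"
  have yV: "y \<in> V" using xV V unfolding y_def by (simp add: subspace_diff subspace_scale)
  have "y \<bullet> y = 0"
  proof (rule quadratic_nonneg_imp_linear_coeff_zero)
    fix t :: real
    have "x + t *\<^sub>R y \<in> V" using xV yV V(1) by (simp add: subspace_add subspace_scale)
    from bound[OF this]
    have "0 \<le> c * ((x + t *\<^sub>R y) \<bullet> (x + t *\<^sub>R y)) - (x + t *\<^sub>R y) \<bullet> f (x + t *\<^sub>R y)" by simp
    also have "\<dots> = c * (x \<bullet> x) - x \<bullet> f x + 2 * t * (c * (x \<bullet> y) - f x \<bullet> y)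
        + t\<^sup>2 * (c * (y \<bullet> y) - y \<bullet> f y)"
      by (simp add: linear_cmul[OF f] linear_add[OF f] inner_add sa[of x y]
          inner_commute[of y x] inner_commute[of y "f x"] algebra_simps power2_eq_square)
    also have "c * (x \<bullet> x) - x \<bullet> f x = 0" by (simp add: xx c_def)
    also have "c * (x \<bullet> y) - f x \<bullet> y = y \<bullet> y"
      by (subst (3) y_def) (simp add: inner_diff_left)
    finally show "0 \<le> 2 * t * (y \<bullet> y) + t\<^sup>2 * (c * (y \<bullet> y) - y \<bullet> f y)" by simp
  qed
  then have "f x = c *\<^sub>R x" by (simp add: y_def)
  then show ?thesis using that xV x by auto
qed

definition orthonormal_set :: "'a::euclidean_space set \<Rightarrow> bool" where
  "orthonormal_set B \<longleftrightarrow> pairwise orthogonal B \<and> (\<forall>b\<in>B. norm b = 1)"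

lemma orthonormal_set_independent: "orthonormal_set B \<Longrightarrow> independent B"
  by (rule pairwise_orthogonal_independent) (auto simp: orthonormal_set_def)

lemma orthonormal_set_finite: "orthonormal_set B \<Longrightarrow> finite B"
  by (simp add: independent_imp_finite orthonormal_set_independent)

lemma orthonormal_set_inner:
  assumes "orthonormal_set B" "a \<in> B" "b \<in> B"
  shows "a \<bullet> b = (if a = b then 1 else 0)"
  using assms by (auto simp: orthonormal_set_def pairwise_def orthogonal_def norm_eq_1)

lemma orthonormal_set_expand:
  assumes "orthonormal_set B" "span B = UNIV"
  shows "x = (\<Sum>b\<in>B. (x \<bullet> b) *\<^sub>R b)"
  using orthonormal_basis_expand[of B x] assms orthonormal_set_finite[OF assms(1)]
  by (simp add: orthonormal_set_def)

lemma orthonormal_set_inner_expand: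
  assumes "orthonormal_set B" "span B = UNIV"
  shows "x \<bullet> y = (\<Sum>b\<in>B. (x \<bullet> b) * (y \<bullet> b))"
proof -
  have "x \<bullet> y = x \<bullet> (\<Sum>b\<in>B. (y \<bullet> b) *\<^sub>R b)"
    using orthonormal_set_expand[OF assms, of y] by simp
  then show ?thesis by (simp add: inner_sum_right mult.commute)
qed

text \<open>Take an orthonormal set of eigenvectors of largest cardinality. Its orthogonal
  complement is invariant under \<open>f\<close>, so a nonzero complement would contain one more
  eigenvector.\<close>

lemma self_adjoint_orthonormal_eigenbasis:
  fixes f :: "'a::euclidean_space \<Rightarrow> 'a"
  assumes f: "linear f" and sa: "\<And>x y. x \<bullet> f y = f x \<bullet> y"
  obtains B c where "orthonormal_set B" "span B = UNIV" "\<And>b. b \<in> B \<Longrightarrow> f b = c b *\<^sub>R b"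
proof -
  define Q where "Q B \<longleftrightarrow> orthonormal_set B \<and> (\<forall>b\<in>B. \<exists>c. f b = c *\<^sub>R b)" for B
  have "Q {}" by (simp add: Q_def orthonormal_set_def)
  moreover have "\<forall>B. Q B \<longrightarrow> card B < Suc DIM('a)"
    using independent_bound orthonormal_set_independent unfolding Q_def less_Suc_eq_le by blast
  ultimately obtain B where B: "Q B" and max: "\<And>C. Q C \<Longrightarrow> card C \<le> card B"
    using ex_has_greatest_nat[of Q "{}" card "Suc DIM('a)"] by (metis less_imp_le)
  have on: "orthonormal_set B" using B by (simp add: Q_def)
  have fin: "finite B" by (rule orthonormal_set_finite[OF on])
  have "span B = UNIV"
  proof (rule ccontr)
    assume "span B \<noteq> UNIV"
    then obtain z where z: "z \<noteq> 0" "\<And>y. y \<in> span B \<Longrightarrow> orthogonal z y"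
      using orthogonal_to_subspace_exists_gen[of B UNIV] by (auto simp: span_UNIV)
    define V where "V = {x. \<forall>b\<in>B. orthogonal x b}"
    have "subspace V"
      by (auto simp: V_def subspace_def orthogonal_def inner_add_left)
    moreover have "f x \<in> V" if "x \<in> V" for x
    proof -
      have "f x \<bullet> b = 0" if "b \<in> B" for b
      proof -
        obtain c where "f b = c *\<^sub>R b" using B \<open>b \<in> B\<close> by (auto simp: Q_def)
        then show ?thesis using \<open>x \<in> V\<close> \<open>b \<in> B\<close> sa[of x b] by (simp add: V_def orthogonal_def)
      qed
      then show ?thesis by (simp add: V_def orthogonal_def)
    qed
    moreover have "z \<in> V" using z by (auto simp: V_def span_base)
    ultimately obtain x c where x: "x \<in> V" "norm x = 1" "f x = c *\<^sub>R x"
      using self_adjoint_eigenvector_in_subspace[OF f sa] z(1) by blast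
    have "x \<notin> B" using x by (auto simp: V_def orthogonal_def)
    moreover have "Q (insert x B)"
      using B x by (auto simp: Q_def orthonormal_set_def V_def pairwise_insert orthogonal_commute)
    ultimately show False using max[of "insert x B"] fin by simp
  qed
  moreover obtain c where "\<And>b. b \<in> B \<Longrightarrow> f b = c b *\<^sub>R b"
    using B unfolding Q_def by metis
  ultimately show ?thesis using that on by blast
qed

lemma symmetric_matrix_inner:
  fixes M :: "real^'n^'n"
  assumes "transpose M = M"
  shows "x \<bullet> (M *v y) = (M *v x) \<bullet> y"
  by (metis assms dot_lmul_matrix transpose_matrix_vector)

lemma transpose_eqI:
  fixes M :: "real^'n^'n"
  assumes "\<And>x y. x \<bullet> (M *v y) = (M *v x) \<bullet> y"
  shows "transpose M = M"
proof -
  have "transpose M *v x = M *v x" for x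
    by (rule vector_eq_rdot[THEN iffD1]) (simp add: dot_lmul_matrix assms)
  then show ?thesis by (simp add: matrix_eq)
qed

lemma symmetric_matrix_orthonormal_eigenbasis:
  fixes M :: "real^'n^'n"
  assumes "transpose M = M"
  obtains B c where "orthonormal_set B" "span B = UNIV" "\<And>b. b \<in> B \<Longrightarrow> M *v b = c b *\<^sub>R b"
  using self_adjoint_orthonormal_eigenbasis[of "(*v) M"] symmetric_matrix_inner[OF assms] by auto

section \<open>Existence and uniqueness of the positive semidefinite square root\<close>

text \<open>Diagonalise \<open>M\<close> and replace each eigenvalue by its square root; the map
  \<open>g\<close> does this in the eigenbasis.\<close>

lemma psd_sqrt_exists:
  fixes M :: "real^'n^'n"
  assumes "psd M"
  shows "\<exists>S. psd S \<and> S ** S = M"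
proof -
  have M: "transpose M = M" and pos: "\<And>x. 0 \<le> x \<bullet> (M *v x)" using assms by (auto simp: psd_def)
  obtain B c where on: "orthonormal_set B" and sp: "span B = UNIV"
    and eig: "\<And>b. b \<in> B \<Longrightarrow> M *v b = c b *\<^sub>R b"
    using symmetric_matrix_orthonormal_eigenbasis[OF M] by metis
  have c: "c b \<ge> 0" if "b \<in> B" for b
    using pos[of b] orthonormal_set_inner[OF on that that] by (simp add: eig[OF that])
  define g where "g x = (\<Sum>b\<in>B. (sqrt (c b) * (x \<bullet> b)) *\<^sub>R b)" for x
  define S where "S = matrix g"
  have "linear g"
    by (rule linearI) (simp_all add: g_def inner_add_left distrib_left scaleR_add_left sum.distrib
        scaleR_right.sum mult.left_commute)
  then have S: "S *v x = g x" for x by (simp add: S_def matrix_works)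
  have inner: "x \<bullet> g y = (\<Sum>b\<in>B. sqrt (c b) * (x \<bullet> b) * (y \<bullet> b))" for x y
    by (simp add: g_def inner_sum_right mult_ac)
  have "transpose S = S"
    by (rule transpose_eqI) (simp add: S inner inner_commute[of "g _"] mult_ac)
  moreover have "0 \<le> x \<bullet> (S *v x)" for x
    by (simp add: S inner mult.assoc c sum_nonneg)
  moreover have "S ** S = M"
  proof (rule matrix_eq[THEN iffD2], rule allI)
    fix x
    have gb: "g x \<bullet> b = sqrt (c b) * (x \<bullet> b)" if "b \<in> B" for b
    proof -
      have "g x \<bullet> b = (\<Sum>a\<in>B. if a = b then sqrt (c b) * (x \<bullet> b) else 0)"
        unfolding g_def inner_sum_left
        by (rule sum.cong) (auto simp: orthonormal_set_inner[OF on _ that])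
      then show ?thesis using that orthonormal_set_finite[OF on] by simp
    qed
    have "(S ** S) *v x = (\<Sum>b\<in>B. (c b * (x \<bullet> b)) *\<^sub>R b)"
      unfolding matrix_vector_mul_assoc[symmetric] S
      by (subst g_def) (rule sum.cong, auto simp: gb c simp flip: mult.assoc)
    also have "\<dots> = (\<Sum>b\<in>B. ((M *v x) \<bullet> b) *\<^sub>R b)"
      by (rule sum.cong) (auto simp: eig simp flip: symmetric_matrix_inner[OF M])
    also have "\<dots> = M *v x" using orthonormal_set_expand[OF on sp] by simp
    finally show "(S ** S) *v x = M *v x" .
  qed
  ultimately show ?thesis by (auto simp: psd_def)
qed

text \<open>Let \<open>b\<close> be an eigenvector of \<open>S\<close> with eigenvalue
  \<open>c b\<close>. Then \<open>T + c b\<close> annihilates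
  \<open>y = T *v b - c b *\<^sub>R b\<close>; since \<open>T\<close> is positive semidefinite,
  \<open>- c b\<close> cannot be a negative eigenvalue of it. So \<open>S\<close> and
  \<open>T\<close> agree on an eigenbasis of \<open>S\<close>.\<close>

lemma psd_square_inj:
  fixes S T :: "real^'n^'n"
  assumes S: "psd S" and T: "psd T" and eq: "S ** S = T ** T"
  shows "S = T"
proof -
  have sS: "transpose S = S" and sT: "transpose T = T" using S T by (auto simp: psd_def)
  obtain B c where on: "orthonormal_set B" and sp: "span B = UNIV"
    and eig: "\<And>b. b \<in> B \<Longrightarrow> S *v b = c b *\<^sub>R b"
    using symmetric_matrix_orthonormal_eigenbasis[OF sS] by metis
  have "S *v b = T *v b" if b: "b \<in> B" for b
  proof -
    have "0 \<le> b \<bullet> (S *v b)" using S by (simp add: psd_def)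
    then have c: "c b \<ge> 0" using orthonormal_set_inner[OF on b b] by (simp add: eig[OF b])
    have "T *v (T *v b) = S *v (S *v b)" by (simp add: matrix_vector_mul_assoc eq)
    then have TT: "T *v (T *v b) = (c b * c b) *\<^sub>R b"
      by (simp add: eig[OF b] matrix_vector_mult_scaleR)
    define y where "y = T *v b - c b *\<^sub>R b"
    have "T *v y = - c b *\<^sub>R y"
      by (simp add: y_def matrix_vector_mult_diff_distrib TT matrix_vector_mult_scaleR
          scaleR_diff_right)
    moreover have "0 \<le> y \<bullet> (T *v y)" using T by (simp add: psd_def)
    ultimately have le: "c b * (y \<bullet> y) \<le> 0" by simp
    have "y = 0"
    \<comment> \<open>For eigenvalue 0 the inequality \<open>le\<close> says nothing; there the
      squared norm of \<open>T *v b\<close> is \<open>b \<bullet> (T *v (T *v b))\<close>, which is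
      0.\<close>
    proof (cases "c b = 0")
      case True
      then have "(T *v b) \<bullet> (T *v b) = 0"
        using TT by (simp flip: symmetric_matrix_inner[OF sT])
      then show ?thesis by (simp add: y_def True)
    next
      case False
      then have "c b > 0" using c by simp
      then show ?thesis using le by (metis inner_gt_zero_iff mult_pos_pos not_le)
    qed
    then show ?thesis by (simp add: y_def eig[OF b])
  qed
  then have "S *v x = T *v x" for x
    using linear_eq_on[of "(*v) S" "(*v) T" x B] sp by auto
  then show ?thesis by (simp add: matrix_eq)
qed

text \<open>Existence and uniqueness together discharge the definite description in
  \<open>psd_sqrt\<close>.\<close>

lemma psd_sqrt_props:
  assumes "psd M"
  shows "psd (psd_sqrt M)" "psd_sqrt M ** psd_sqrt M = M"
proof -
  have "\<exists>!S. psd S \<and> S ** S = M"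
    using psd_sqrt_exists[OF assms] psd_square_inj by metis
  from theI'[OF this] show "psd (psd_sqrt M)" "psd_sqrt M ** psd_sqrt M = M"
    by (auto simp: psd_sqrt_def)
qed

section \<open>The matrix \<open>J\<close>: action, symmetry, kernel and quadratic form\<close>

lemma outer_mult_vec: "outer x y *v z = (y \<bullet> z) *\<^sub>R x"
  by (simp add: vec_eq_iff outer_def matrix_vector_mult_def inner_vec_def sum_distrib_left mult_ac)

lemma newton_J_mult_vec:
  "newton_J A u *v x =
     (let y = x - (u \<bullet> x) *\<^sub>R u; z = A *v y - rayleigh A u *\<^sub>R y in z - (u \<bullet> z) *\<^sub>R u)"
  by (simp add: newton_J_def Let_def outer_mult_vec scaleR_matrix_vector_assoc[symmetric]
      matrix_vector_mult_diff_rdistrib flip: matrix_vector_mul_assoc)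

lemma newton_J_symmetric:
  fixes A :: "real^'n^'n"
  assumes "transpose A = A"
  shows "transpose (newton_J A u) = newton_J A u"
proof -
  have "A $ j $ i = A $ i $ j" for i j
    using assms by (metis transpose_def vec_lambda_beta)
  then have "transpose (A - rayleigh A u *\<^sub>R mat 1) = A - rayleigh A u *\<^sub>R mat 1"
    by (simp add: transpose_def vec_eq_iff mat_def)
  moreover have "transpose (mat 1 - outer u u) = mat 1 - outer u u"
    by (simp add: transpose_def vec_eq_iff mat_def outer_def)
  ultimately show ?thesis
    by (simp add: newton_J_def matrix_transpose_mul matrix_mul_assoc)
qed

lemma newton_J_kernel:
  assumes "norm u = 1"
  shows "newton_J A u *v u = 0"
  using assms by (simp add: newton_J_mult_vec norm_eq_1)

text \<open>The outer factor \<open>mat 1 - outer u u\<close> is symmetric and moves onto the left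
  argument. For \<open>x\<close> orthogonal to \<open>u\<close>, \<open>y\<close> is
  \<open>x\<close> itself, which links \<open>J\<close> to the coercivity estimate.\<close>

lemma newton_J_quadratic_form:
  "x \<bullet> (newton_J A u *v x) =
    (let y = x - (u \<bullet> x) *\<^sub>R u in y \<bullet> (A *v y) - rayleigh A u * (y \<bullet> y))"
proof -
  define y where "y = x - (u \<bullet> x) *\<^sub>R u"
  define z where "z = A *v y - rayleigh A u *\<^sub>R y"
  have "x \<bullet> (newton_J A u *v x) = x \<bullet> (z - (u \<bullet> z) *\<^sub>R u)"
    by (simp add: newton_J_mult_vec Let_def y_def z_def)
  also have "\<dots> = y \<bullet> z"
    by (subst y_def) (simp add: inner_diff_left inner_diff_right inner_commute[of u x])
  also have "\<dots> = y \<bullet> (A *v y) - rayleigh A u * (y \<bullet> y)" by (simp add: z_def inner_diff_right)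
  finally show ?thesis by (simp add: y_def Let_def)
qed

section \<open>Eigenvector expansion of \<open>A\<close> and coercivity near
  \<open>v 1\<close>\<close>

text \<open>Eigenvectors of a symmetric matrix for distinct eigenvalues are orthogonal, and there
  are as many as the dimension. Injectivity is recorded so that sums over the basis can be reindexed
  by \<open>i\<close>.\<close>

lemma ordered_eigenpairs_orthonormal:
  fixes A :: "real^'n^'n"
  assumes "transpose A = A" "ordered_eigenpairs A lam v"
  shows "orthonormal_set (v ` {1..CARD('n)})" "span (v ` {1..CARD('n)}) = UNIV"
    "inj_on v {1..CARD('n)}"
proof -
  let ?I = "{1..CARD('n)}"
  have mono: "strict_mono_on ?I lam" and eig: "\<And>i. i \<in> ?I \<Longrightarrow> A *v v i = lam i *\<^sub>R v i"
    and nrm: "\<And>i. i \<in> ?I \<Longrightarrow> norm (v i) = 1"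
    using assms(2) by (auto simp: ordered_eigenpairs_def)
  have orth: "v i \<bullet> v j = 0" if "i \<in> ?I" "j \<in> ?I" "i \<noteq> j" for i j
  proof -
    have "lam j * (v i \<bullet> v j) = lam i * (v i \<bullet> v j)"
      using symmetric_matrix_inner[OF assms(1), of "v i" "v j"] that by (simp add: eig)
    moreover have "lam i \<noteq> lam j"
      using inj_onD[OF strict_mono_on_imp_inj_on[OF mono]] that by blast
    ultimately show ?thesis by simp
  qed
  show inj: "inj_on v ?I"
  proof (rule inj_onI, rule ccontr)
    fix i j assume ij: "i \<in> ?I" "j \<in> ?I" "v i = v j" "i \<noteq> j"
    show False using orth[OF ij(1,2,4)] nrm[OF ij(2)] unfolding ij(3) by simp
  qed
  show on: "orthonormal_set (v ` ?I)"
    unfolding orthonormal_set_def pairwise_def orthogonal_def using orth nrm by blast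
  have "card (v ` ?I) = DIM(real^'n)" using card_image[OF inj] by simp
  then show "span (v ` ?I) = UNIV"
    using dim_eq_full[of "v ` ?I"] dim_eq_card_independent[OF orthonormal_set_independent[OF on]]
    by simp
qed

text \<open>In the eigenbasis every eigenvalue but the first is at least \<open>lam 2\<close>; the
  subtracted term is exactly the deficit of the first coordinate.\<close>

lemma ordered_eigenpairs_quadratic_form_ge:
  fixes A :: "real^'n^'n"
  assumes "CARD('n) \<ge> 2" "transpose A = A" "ordered_eigenpairs A lam v"
  shows "x \<bullet> (A *v x) \<ge> lam 2 * (x \<bullet> x) - (lam 2 - lam 1) * (x \<bullet> v 1)\<^sup>2"
proof -
  let ?I = "{1..CARD('n)}"
  note on = ordered_eigenpairs_orthonormal[OF assms(2,3)]
  have mono: "strict_mono_on ?I lam" and eig: "\<And>i. i \<in> ?I \<Longrightarrow> A *v v i = lam i *\<^sub>R v i"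
    using assms(3) by (auto simp: ordered_eigenpairs_def)
  have expand: "a \<bullet> b = (\<Sum>i\<in>?I. (a \<bullet> v i) * (b \<bullet> v i))" for a b
    using orthonormal_set_inner_expand[OF on(1,2), of a b] 
    unfolding sum.reindex[OF on(3)] by simp
  have one: "1 \<in> ?I" using assms(1) by simp
  have "lam 2 * (x \<bullet> x) - (lam 2 - lam 1) * (x \<bullet> v 1)\<^sup>2
      = (\<Sum>i\<in>?I. lam 2 * (x \<bullet> v i)\<^sup>2 - (if i = 1 then (lam 2 - lam 1) * (x \<bullet> v 1)\<^sup>2 else 0))"
    using one by (simp add: expand[of x x] sum_subtractf sum_distrib_left power2_eq_square)
  also have "\<dots> \<le> (\<Sum>i\<in>?I. lam i * (x \<bullet> v i)\<^sup>2)"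
  proof (rule sum_mono)
    fix i assume i: "i \<in> ?I"
    show "lam 2 * (x \<bullet> v i)\<^sup>2 - (if i = 1 then (lam 2 - lam 1) * (x \<bullet> v 1)\<^sup>2 else 0)
        \<le> lam i * (x \<bullet> v i)\<^sup>2"
    proof (cases "i = 1")
      case True
      then show ?thesis by (simp add: algebra_simps)
    next
      case False
      then have "lam 2 \<le> lam i"
        using strict_mono_on_leD[OF mono, of 2 i] i assms(1) by auto
      then show ?thesis using False by (simp add: mult_right_mono)
    qed
  qed
  also have "\<dots> = x \<bullet> (A *v x)"
    unfolding expand[of x "A *v x"]
    by (rule sum.cong)
      (auto simp: eig power2_eq_square simp flip: symmetric_matrix_inner[OF assms(2)])
  finally show ?thesis .
qed

text \<open>A vector orthogonal to \<open>u\<close> is nearly orthogonal to \<open>v 1\<close>, so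
  its quadratic form is nearly at least \<open>lam 2\<close> times its squared norm, while the
  Rayleigh quotient of \<open>u\<close> is close to \<open>lam 1\<close>.\<close>

lemma newton_J_coercive_near_eigenvector:
  fixes A :: "real^'n^'n"
  assumes card: "CARD('n) \<ge> 2" and A: "transpose A = A" and eigs: "ordered_eigenpairs A lam v"
  shows "\<exists>\<delta>>0. \<forall>u. norm (u - v 1) < \<delta> \<longrightarrow>
    (\<forall>w. w \<bullet> u = 0 \<longrightarrow>
      w \<bullet> (A *v w) - rayleigh A u * (w \<bullet> w) \<ge> (lam 2 - lam 1) / 2 * (w \<bullet> w))"
proof -
  define \<gamma> where "\<gamma> = lam 2 - lam 1"
  have \<gamma>: "\<gamma> > 0"
    using eigs card strict_mono_onD[of "{1..CARD('n)}" lam 1 2]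
    by (auto simp: ordered_eigenpairs_def \<gamma>_def)
  have "v 1 \<bullet> v 1 = 1" "A *v v 1 = lam 1 *\<^sub>R v 1"
    using eigs card by (auto simp: ordered_eigenpairs_def norm_eq_1)
  then have ray: "rayleigh A (v 1) = lam 1" by (simp add: rayleigh_def)
  have "isCont (rayleigh A) (v 1)"
    unfolding rayleigh_def
    by (intro continuous_intros linear_continuous_at) 
      (simp add: linear_conv_bounded_linear[symmetric])
  \<comment> \<open>The gap \<open>\<gamma>\<close> is spent in two quarters: one on the Rayleigh
    quotient, the other on the component of \<open>w\<close> along \<open>v 1\<close>, where the
    radius 1/2 enters squared. This leaves \<open>\<gamma> / 2\<close>.\<close>
  then obtain d where d: "d > 0" "\<And>u. norm (u - v 1) < d \<Longrightarrow> \<bar>rayleigh A u - lam 1\<bar> < \<gamma> / 4"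
    using \<gamma> unfolding continuous_at_eps_delta dist_norm ray
    by (metis divide_pos_pos real_norm_def zero_less_numeral)
  have "\<gamma> / 2 * (w \<bullet> w) \<le> w \<bullet> (A *v w) - rayleigh A u * (w \<bullet> w)"
    if u: "norm (u - v 1) < min d (1 / 2)" and w: "w \<bullet> u = 0" for u w
  proof -
    have "w \<bullet> v 1 = - (w \<bullet> (u - v 1))" using w by (simp add: inner_diff_right)
    then have "\<bar>w \<bullet> v 1\<bar> \<le> norm w * norm (u - v 1)"
      using Cauchy_Schwarz_ineq2[of w "u - v 1"] by simp
    also have "\<dots> \<le> norm w * (1 / 2)" using u by (intro mult_left_mono) auto
    finally have "\<bar>w \<bullet> v 1\<bar>\<^sup>2 \<le> (norm w * (1 / 2))\<^sup>2" by (intro power_mono) auto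
    then have "(w \<bullet> v 1)\<^sup>2 \<le> (w \<bullet> w) / 4"
      by (simp add: power_mult_distrib power2_norm_eq_inner power_divide)
    then have "\<gamma> * (w \<bullet> v 1)\<^sup>2 \<le> \<gamma> * ((w \<bullet> w) / 4)" using \<gamma> by (intro mult_left_mono) auto
    moreover have "rayleigh A u * (w \<bullet> w) \<le> (lam 1 + \<gamma> / 4) * (w \<bullet> w)"
    proof (rule mult_right_mono)
      show "rayleigh A u \<le> lam 1 + \<gamma> / 4" using d(2)[of u] u by linarith
    qed simp
    moreover have "lam 2 = lam 1 + \<gamma>" by (simp add: \<gamma>_def)
    ultimately show ?thesis
      using ordered_eigenpairs_quadratic_form_ge[OF card A eigs, of w] by (simp add: algebra_simps)
  qed
  then show ?thesis using d(1) unfolding \<gamma>_def[symmetric] by (intro exI[of _ "min d (1/2)"]) auto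
qed

section \<open>Unit iterates, the error norm and the preconditioner bound\<close>

lemma newton_iteration_norm:
  assumes "newton_iteration A u s"
  shows "norm (u k) = 1"
proof (induction k)
  case 0
  then show ?case using assms by (simp add: newton_iteration_def)
next
  case (Suc k)
  have "s k \<bullet> u k = 0" using assms by (simp add: newton_iteration_def)
  \<comment> \<open>Orthogonality of \<open>s k\<close> and \<open>u k\<close> rules out
    \<open>u k + s k = 0\<close>, where division by zero would make the next iterate 0.\<close>
  then have "(u k + s k) \<bullet> u k = 1" using Suc by (simp add: inner_add_left norm_eq_1)
  then have "u k + s k \<noteq> 0" by auto
  moreover have "u (Suc k) = (1 / norm (u k + s k)) *\<^sub>R (u k + s k)"
    using assms by (simp add: newton_iteration_def)
  ultimately show ?case by simp
qed

text \<open>The operator norm bounds the values on the unit sphere, so the real supremum in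
  \<open>error_norm\<close> is a genuine upper bound; scaling does the rest.\<close>

lemma error_norm_bound:
  fixes E :: "real^'n^'n"
  assumes z: "z \<bullet> u = 0"
  shows "\<bar>z \<bullet> (E *v z)\<bar> \<le> error_norm u E * (z \<bullet> z)"
proof (cases "z = 0")
  case True
  then show ?thesis by simp
next
  case False
  let ?Z = "{z. z \<bullet> u = 0 \<and> norm z = 1}" and ?y = "(1 / norm z) *\<^sub>R z"
  have "\<bar>x \<bullet> (E *v x)\<bar> \<le> onorm ((*v) E)" if "x \<in> ?Z" for x
  proof -
    have "\<bar>x \<bullet> (E *v x)\<bar> \<le> norm x * norm (E *v x)" by (rule Cauchy_Schwarz_ineq2)
    also have "\<dots> \<le> onorm ((*v) E)"
      using onorm[of "(*v) E" x] that by (simp add: linear_conv_bounded_linear[symmetric])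
    finally show ?thesis .
  qed
  then have "bdd_above ((\<lambda>z. \<bar>z \<bullet> (E *v z)\<bar>) ` ?Z)" by (intro bdd_aboveI2)
  moreover have "?y \<in> ?Z" using z False by simp
  ultimately have "\<bar>?y \<bullet> (E *v ?y)\<bar> \<le> error_norm u E"
    unfolding error_norm_def by (rule cSUP_upper2) simp
  then have "\<bar>z \<bullet> (E *v z)\<bar> / (norm z)\<^sup>2 \<le> error_norm u E"
    by (simp add: matrix_vector_mult_scaleR power2_eq_square abs_mult)
  then show ?thesis using False by (simp add: field_simps power2_norm_eq_inner)
qed

text \<open>The estimate for a single unit vector, with an abstract coercivity constant
  \<open>m\<close>. Half the spectral gap as \<open>m\<close> turns \<open>1 / m\<close> into the
  factor of the theorem.\<close>

lemma precond_norm_le: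
  fixes A :: "real^'n^'n"
  assumes card: "CARD('n) \<ge> 2" and A: "transpose A = A" and u: "norm u = 1" and m: "m > 0"
    and coercive: "\<And>w. w \<bullet> u = 0 \<Longrightarrow> m * (w \<bullet> w) \<le> w \<bullet> (A *v w) - rayleigh A u * (w \<bullet> w)"
  shows "precond_norm u P \<le> 1 / m * (1 + error_norm u (precond_error A u P))"
proof -
  define S where "S = psd_sqrt (newton_J A u)"
  define E where "E = precond_error A u P"
  have uu: "u \<bullet> u = 1" using u by (simp add: norm_eq_1)
  have "psd (newton_J A u)"
    unfolding psd_def
  proof (intro conjI allI newton_J_symmetric[OF A])
    fix x
    define y where "y = x - (u \<bullet> x) *\<^sub>R u"
    have "y \<bullet> u = 0" by (simp add: y_def inner_diff_left uu inner_commute[of u x])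
    from coercive[OF this] m show "0 \<le> x \<bullet> (newton_J A u *v x)"
      unfolding newton_J_quadratic_form y_def[symmetric] Let_def
      by (meson inner_ge_zero less_imp_le mult_nonneg_nonneg order_trans)
  qed
  note S = psd_sqrt_props[OF this, folded S_def]
  have Ssym: "x \<bullet> (S *v y) = (S *v x) \<bullet> y" for x y
    using S(1) symmetric_matrix_inner by (auto simp: psd_def)
  have Ssq: "(S *v x) \<bullet> (S *v x) = x \<bullet> (newton_J A u *v x)" for x
    by (simp add: matrix_vector_mul_assoc S(2) flip: Ssym)
  \<comment> \<open>The squared norm of \<open>S *v u\<close> is \<open>u \<bullet> (J u)\<close>,
    which is 0. By symmetry the whole range of \<open>S\<close> is then orthogonal to
    \<open>u\<close>.\<close>
  have Su: "S *v u = 0" using Ssq[of u] by (simp add: newton_J_kernel[OF u])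
  have Sperp: "(S *v x) \<bullet> u = 0" for x by (simp add: Su flip: Ssym)
  have Sge: "m * (z \<bullet> z) \<le> (S *v z) \<bullet> (S *v z)" if "z \<bullet> u = 0" for z
    using coercive[OF that] that
    by (simp add: Ssq newton_J_quadratic_form inner_commute[of u])
  have surj: "\<exists>z. z \<bullet> u = 0 \<and> S *v z = w" if w: "w \<bullet> u = 0" for w
  proof -
    \<comment> \<open>\<open>S\<close> is singular along \<open>u\<close>. Adding
      \<open>outer u u\<close> makes it injective, hence surjective, without changing it on the
      complement of \<open>u\<close>. As \<open>T\<close> preserves the inner product with
      \<open>u\<close>, a preimage of \<open>w\<close> lies in that complement.\<close>
    define T where "T = S + outer u u"
    have T: "T *v z = S *v z + (u \<bullet> z) *\<^sub>R u" for z
      by (simp add: T_def matrix_vector_mult_add_rdistrib outer_mult_vec)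
    have Tu: "(T *v z) \<bullet> u = z \<bullet> u" for z
      by (simp add: T inner_add_left Sperp uu inner_commute[of u z])
    have "z = 0" if "T *v z = 0" for z
    proof -
      have zu: "z \<bullet> u = 0" using Tu[of z] that by simp
      then have "S *v z = 0" using that by (simp add: T inner_commute[of u z])
      then have "m * (z \<bullet> z) \<le> 0" using Sge[OF zu] by simp
      then show ?thesis using m
        by (metis inner_gt_zero_iff mult_pos_pos not_le)
    qed
    then have "inj ((*v) T)" by (simp add: linear_injective_0)
    then have "surj ((*v) T)" by (intro linear_injective_imp_surjective) auto
    then obtain z where z: "T *v z = w" by (metis surjD)
    then have "z \<bullet> u = 0" using Tu w by metis
    then show ?thesis using z by (auto simp: T inner_commute[of u z])
  qed
  have bound: "(w \<bullet> (P *v w)) / (w \<bullet> w) \<le> 1 / m * (1 + error_norm u E)"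
    if w: "w \<bullet> u = 0" "w \<noteq> 0" for w
  proof -
    obtain z where z: "z \<bullet> u = 0" "S *v z = w" using surj[OF w(1)] by auto
    have "z \<noteq> 0" using z w by auto
    then have zz: "z \<bullet> z > 0" by simp
    have "z \<bullet> (E *v z) = z \<bullet> z - z \<bullet> (S *v (P *v (S *v z)))"
      by (simp add: E_def precond_error_def S_def[symmetric] matrix_vector_mult_diff_rdistrib
          inner_diff_right flip: matrix_vector_mul_assoc)
    then have eq: "w \<bullet> (P *v w) = z \<bullet> z - z \<bullet> (E *v z)" by (simp add: Ssym z)
    have Eb: "\<bar>z \<bullet> (E *v z)\<bar> \<le> error_norm u E * (z \<bullet> z)" by (rule error_norm_bound[OF z(1)])
    \<comment> \<open>Nonnegativity of the error norm is read off from its bound at the nonzero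
      \<open>z\<close>; it justifies multiplying the estimate for \<open>z \<bullet> z\<close> by
      \<open>1 + error_norm u E\<close>.\<close>
    then have "0 \<le> error_norm u E * (z \<bullet> z)" by linarith
    then have e: "0 \<le> error_norm u E" using zz by (simp add: zero_le_mult_iff)
    have "w \<bullet> (P *v w) \<le> (1 + error_norm u E) * (z \<bullet> z)"
      using eq Eb by (simp add: algebra_simps)
    also have "\<dots> \<le> (1 + error_norm u E) * ((w \<bullet> w) / m)"
      using Sge[OF z(1)] z(2) m e by (intro mult_left_mono) (auto simp: field_simps)
    finally show ?thesis using w(2) by (simp add: pos_divide_le_eq)
  qed
  \<comment> \<open>Dimension at least 2 makes the index set of the supremum nonempty, as
    \<open>cSUP_least\<close> requires.\<close>
  obtain w where "w \<noteq> 0" "orthogonal u w"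
    using orthogonal_to_vector_exists[of u] card by auto
  then have "{w. w \<bullet> u = 0 \<and> w \<noteq> 0} \<noteq> {}" by (auto simp: orthogonal_def inner_commute)
  then show ?thesis
    unfolding precond_norm_def E_def[symmetric] using bound by (intro cSUP_least) auto
qed

theorem lemma3p3:
  fixes A :: "real^('n::{finite,linorder})^('n::{finite,linorder})"
    and lam :: "nat \<Rightarrow> real" and v :: "nat \<Rightarrow> real^('n::{finite,linorder})"
  assumes "CARD('n) \<ge> 2"
    and "spd A"
    and "ordered_eigenpairs A lam v"
  shows "\<exists>\<delta>>0. \<forall>u s L P. newton_iteration A u s \<longrightarrow> precond_sequence A u s L P \<longrightarrow>
    (\<forall>k. norm (u k - v 1) < \<delta> \<longrightarrow>
      precond_norm (u k) (P k)
        \<le> 2 / (lam 2 - lam 1) * (1 + error_norm (u k) (precond_error A (u k) (P k))))"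
proof -
  have A: "transpose A = A" using assms(2) by (simp add: spd_def)
  have "lam 1 < lam 2"
    using assms(1,3) strict_mono_onD[of "{1..CARD('n)}" lam 1 2]
    by (auto simp: ordered_eigenpairs_def)
  then have m: "(lam 2 - lam 1) / 2 > 0" by simp
  \<comment> \<open>The radius is fixed before any iteration or preconditioner is introduced, so it
    is uniform in these and in \<open>k\<close>.\<close>
  obtain \<delta> where \<delta>: "\<delta> > 0" and coercive: "\<And>u w. norm (u - v 1) < \<delta> \<Longrightarrow> w \<bullet> u = 0 \<Longrightarrow>
      (lam 2 - lam 1) / 2 * (w \<bullet> w) \<le> w \<bullet> (A *v w) - rayleigh A u * (w \<bullet> w)"
    using newton_J_coercive_near_eigenvector[OF assms(1) A assms(3)] by blast
  have "precond_norm (u k) (P k)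
      \<le> 2 / (lam 2 - lam 1) * (1 + error_norm (u k) (precond_error A (u k) (P k)))"
    if "newton_iteration A u s" "norm (u k - v 1) < \<delta>" for u s k P
    using precond_norm_le[OF assms(1) A newton_iteration_norm[OF that(1)] m coercive[OF that(2)]]
    by simp
  then show ?thesis using \<delta> by blast
qed

end
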